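(* Consider the two-department staff selection game with $N$ candidates and equally attractive departments described in the context. For $N\ge 3$, the libertarian equilibria (that is, the libertarian $1$ and the libertarian $2$ correlated equilibria) are the only globally optimal utilitarian equilibria of the $N$-candidate game, ignoring strategies whose actions differ from those defined by one of these libertarian strategies on a set with probability measure zero.
   Context: **The game.** Two players (departmental heads) observe one by one $N$ candidates whose levels of expertise are i.i.d. uniform on $[0,1]$. Each player wants to hire one candidate. As each candidate appears, the players still searching simultaneously choose $s$ (stop, i.e. make an offer) or $f$ (continue), and rejected candidates cannot be recalled. If both make an offer, the candidate joins each department with probability $\tfrac12$. A player who hires a candidate of expertise $x$ gains $x$ and leaves the game, and the other player then searches alone optimally. A player who hires nobody suffers a cost $c$ (gets $-c$). **Lone searcher.** Let $u_n$ be the optimal expected reward of a lone searcher with $n$ candidates remaining: $u_1=\tfrac12$ and $u_{n}=\int_0^1\max\{x,u_{n-1}\}\,dx$ for $n\ge 2$. **Stages.** Stages are counted from the end: stage $n$ is the stage at which the $n$-th last candidate is seen while both players are still searching. At stage $1$ both players want to select the candidate and make an offer, which gives each the value $v_1=w_1=d:=\frac{1-2c}{4}$. For $n\ge 2$, given the values $v_{n-1},w_{n-1}$ of the $(n-1)$-stage game to Players 1 and 2, the game played on observing a candidate of expertise $x$ at stage $n$ is the $2\times 2$ bimatrix game $M_n(x)$ (Player 1 chooses the row, Player 2 the column; the payoff to Player 1 is written first) with payoffs - $(s,s)$: $\left(\frac{x+u_{n-1}}2,\frac{x+u_{n-1}}2\right)$; - $(s,f)$: $(x,u_{n-1})$;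 - $(f,s)$: $(u_{n-1},x)$; - $(f,f)$: $(v_{n-1},w_{n-1})$. **Correlated equilibria.** A correlated strategy in the $N$-candidate game is a sequence $\pi=(\mu_2,\dots,\mu_N)$ of measurable maps $\mu_n=(\mu_{n,ss},\mu_{n,ff},\mu_{n,fs},\mu_{n,sf})$ from $[0,1]$ to the probability distributions on $\{s,f\}^2$; for example, $\mu_{n,fs}(x)$ is the probability that Player 1 is told to play $f$ and Player 2 to play $s$ on a candidate of expertise $x$ at stage $n$. The values are defined recursively by $v_1^\pi=w_1^\pi=d$ and, for $2\le n\le N$, by letting $v_n^\pi$ (respectively $w_n^\pi$) be the integral over $x\in[0,1]$ of the expected payoff to Player 1 (respectively Player 2) under $\mu_n(x)$ in the game $M_n(x)$ formed with $v_{n-1}=v_{n-1}^\pi$, $w_{n-1}=w_{n-1}^\pi$. Correlated equilibria are defined by recursion: $\pi$ is a correlated equilibrium if, for every $2\le n\le N$ and every $x\in[0,1]$, $\mu_n(x)$ is a correlated equilibrium (in Aumann's sense) of the bimatrix game $M_n(x)$ formed with $v_{n-1}^\pi,w_{n-1}^\pi$. **Selection criteria.** A correlated equilibrium is constructed recursively, from the last stages backwards. It is: - *utilitarian* if at each stage $n$ the sum $v_n+w_n$ of the values of the game to the players is maximised (over correlated equilibria at that stage), given that the equilibrium already calculated for the later stages is played; - *libertarian $i$* ($i=1,2$) if at each stage $n$ the value of the game to Player $i$ ($v_n$ for $i=1$, $w_n$ for $i=2$) is maximised, given that the equilibrium already calculated for the later stages is played. The utilitarian choice at a stage need not be unique,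 and different choices can lead to different values at earlier-played stages. A utilitarian equilibrium $\pi$ of the $N$-candidate game is *globally optimal* if it is optimal in the sense of the utilitarian criterion among all utilitarian equilibria, i.e. $v_N^\pi+w_N^\pi\ge v_N^{\pi'}+w_N^{\pi'}$ for every utilitarian equilibrium $\pi'$ of the $N$-candidate game.
   Formalization: Uniqueness fails as stated: at stage N, for max(v,w)<x<u (values at stage N-1), (s,s), (s,f), (f,s) give the same payoff sum. So agreement with a libertarian equilibrium is claimed a.e. at stages 2..N-1, and at stage N only off that interval; cost c is taken as c>=0. *)

theory Defs
  imports "HOL-Probability.Probability"
begin

text \<open>The distribution of a candidate's level of expertise.\<close>

abbreviation U01 :: "real measure" where
  "U01 \<equiv> restrict_space lborel {0..1}"

datatype action = Stop | Continue

lemma UNIV_action: "UNIV = {Stop, Continue}"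
  using action.exhaust by auto

instance action :: finite
  by standard (simp add: UNIV_action)

type_synonym profile = "action \<times> action"
type_synonym bimatrix = "profile \<Rightarrow> real \<times> real"

text \<open>
  Correlated equilibrium in the sense of Aumann: a player recommended an action cannot gain by
  switching to another one. The conditional expectations given the recommendation are multiplied
  through by its probability, so recommendations of probability zero impose no condition.
\<close>

definition correlated_equilibrium :: "bimatrix \<Rightarrow> profile pmf \<Rightarrow> bool" where
  "correlated_equilibrium g p \<longleftrightarrow>
     (\<forall>a a'. (\<Sum>b\<in>UNIV. pmf p (a, b) * fst (g (a', b))) \<le> (\<Sum>b\<in>UNIV. pmf p (a, b) * fst (g (a, b)))) \<and>
     (\<forall>b b'. (\<Sum>a\<in>UNIV. pmf p (a, b) * snd (g (a, b'))) \<le> (\<Sum>a\<in>UNIV. pmf p (a, b) * snd (g (a, b))))"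

text \<open>Optimal expected reward of a lone searcher; the value at \<open>0\<close> is never used.\<close>

fun lone_value :: "nat \<Rightarrow> real" where
  "lone_value 0 = 0"
| "lone_value (Suc 0) = 1 / 2"
| "lone_value (Suc (Suc n)) = (LINT x|U01. max x (lone_value (Suc n)))"

text \<open>
  The game played at stage \<open>n \<ge> 2\<close> on a candidate of expertise \<open>x\<close>, where \<open>vw\<close> is the pair of
  values of the \<open>(n - 1)\<close>-stage game to Players 1 and 2.
\<close>

fun stage_game :: "nat \<Rightarrow> real \<times> real \<Rightarrow> real \<Rightarrow> bimatrix" where
  "stage_game n vw x (Stop, Stop) = ((x + lone_value (n - 1)) / 2, (x + lone_value (n - 1)) / 2)"
| "stage_game n vw x (Stop, Continue) = (x, lone_value (n - 1))"
| "stage_game n vw x (Continue, Stop) = (lone_value (n - 1), x)"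
| "stage_game n vw x (Continue, Continue) = vw"

text \<open>
  A correlated strategy in the \<open>N\<close>-candidate game is represented by a function of which only the
  stages \<open>2, \<dots>, N\<close> and the arguments in \<open>[0, 1]\<close> matter.
\<close>

type_synonym stage_strategy = "real \<Rightarrow> profile pmf"
type_synonym strategy = "nat \<Rightarrow> stage_strategy"

definition stage_value :: "nat \<Rightarrow> real \<times> real \<Rightarrow> stage_strategy \<Rightarrow> real \<times> real" where
  "stage_value n vw \<mu> =
     ((LINT x|U01. measure_pmf.expectation (\<mu> x) (\<lambda>a. fst (stage_game n vw x a))),
      (LINT x|U01. measure_pmf.expectation (\<mu> x) (\<lambda>a. snd (stage_game n vw x a))))"

text \<open>The values of the game with cost \<open>c\<close> to the two players; stage \<open>0\<close> is never used.\<close>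

fun game_value :: "real \<Rightarrow> strategy \<Rightarrow> nat \<Rightarrow> real \<times> real" where
  "game_value c \<pi> 0 = (0, 0)"
| "game_value c \<pi> (Suc 0) = ((1 - 2 * c) / 4, (1 - 2 * c) / 4)"
| "game_value c \<pi> (Suc (Suc n)) =
     stage_value (Suc (Suc n)) (game_value c \<pi> (Suc n)) (\<pi> (Suc (Suc n)))"

definition stage_equilibrium :: "nat \<Rightarrow> real \<times> real \<Rightarrow> stage_strategy \<Rightarrow> bool" where
  "stage_equilibrium n vw \<mu> \<longleftrightarrow>
     (\<forall>a. (\<lambda>x. pmf (\<mu> x) a) \<in> borel_measurable U01) \<and>
     (\<forall>x\<in>{0..1}. correlated_equilibrium (stage_game n vw x) (\<mu> x))"

definition game_equilibrium :: "real \<Rightarrow> nat \<Rightarrow> strategy \<Rightarrow> bool" where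
  "game_equilibrium c N \<pi> \<longleftrightarrow>
     (\<forall>n\<in>{2..N}. stage_equilibrium n (game_value c \<pi> (n - 1)) (\<pi> n))"

text \<open>
  At each stage the criterion \<open>f\<close> of the pair of values is maximised over the correlated equilibria
  of that stage, given what \<open>\<pi>\<close> prescribes at the later-played (lower-numbered) stages.
\<close>

definition selected_by :: "(real \<times> real \<Rightarrow> real) \<Rightarrow> real \<Rightarrow> nat \<Rightarrow> strategy \<Rightarrow> bool" where
  "selected_by f c N \<pi> \<longleftrightarrow> game_equilibrium c N \<pi> \<and>
     (\<forall>n\<in>{2..N}. \<forall>\<mu>. stage_equilibrium n (game_value c \<pi> (n - 1)) \<mu> \<longrightarrow>
        f (stage_value n (game_value c \<pi> (n - 1)) \<mu>) \<le> f (game_value c \<pi> n))"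

definition total :: "real \<times> real \<Rightarrow> real" where
  "total vw = fst vw + snd vw"

definition utilitarian :: "real \<Rightarrow> nat \<Rightarrow> strategy \<Rightarrow> bool" where
  "utilitarian = selected_by total"

definition libertarian1 :: "real \<Rightarrow> nat \<Rightarrow> strategy \<Rightarrow> bool" where
  "libertarian1 = selected_by fst"

definition libertarian2 :: "real \<Rightarrow> nat \<Rightarrow> strategy \<Rightarrow> bool" where
  "libertarian2 = selected_by snd"

definition globally_optimal :: "real \<Rightarrow> nat \<Rightarrow> strategy \<Rightarrow> bool" where
  "globally_optimal c N \<pi> \<longleftrightarrow> utilitarian c N \<pi> \<and>
     (\<forall>\<pi>'. utilitarian c N \<pi>' \<longrightarrow> total (game_value c \<pi>' N) \<le> total (game_value c \<pi> N))"

text \<open>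
  The levels of expertise at stage \<open>n\<close> at which each player would rather have the other one make
  the only offer, but would make an offer if the other one did not. There \<open>(s,s)\<close>, \<open>(s,f)\<close> and
  \<open>(f,s)\<close> yield the same sum of payoffs. At the first-played stage \<open>n = N\<close>, on whose values no
  other stage depends, even the global form of the utilitarian criterion therefore cannot
  distinguish between them.
\<close>

definition tie_region :: "real \<Rightarrow> strategy \<Rightarrow> nat \<Rightarrow> real set" where
  "tie_region c \<pi> n =
     {max (fst (game_value c \<pi> (n - 1))) (snd (game_value c \<pi> (n - 1))) <..< lone_value (n - 1)}"

end

theory Submission
  imports Defs
begin

text \<open>
  Let \<open>u\<close> be the lone value and \<open>v, w < u\<close> the continuation values at some stage, and let \<open>x\<close> be
  outside the null set \<open>{u, v, w}\<close>. Dominance makes the equilibrium unique unless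
  \<open>max v w < x < u\<close>; there the payoffs add up to at most \<open>x + u\<close>, with equality iff \<open>(f,f)\<close> has
  probability \<open>0\<close>, and Player 1 gets at most \<open>u\<close>, with equality iff \<open>(f,s)\<close> is played.
  Hence libertarian equilibria are unique almost everywhere and utilitarian.

  The best total at a stage increases with \<open>v + w\<close> and decreases with \<open>min v w\<close>. A utilitarian
  strategy gives each player at least \<open>least_payoff\<close> at \<open>x\<close>, so the smaller of the two values is
  bounded below by a function that is strictly increasing in its predecessor. The libertarian
  equilibria attain the bound, and equality forces the same player to be the favoured one at every
  stage: once \<open>w < v\<close>, Player 1 cannot be the one with the least value, as he gets \<open>u\<close> instead of
  \<open>x\<close> for \<open>w < x < v\<close>. So the libertarian equilibria are optimal, and a utilitarian equilibrium
  is globally optimal iff it agrees with one of them before the first-played stage.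
\<close>

section \<open>Finite action sets and the equilibrium inequalities of a stage game\<close>

lemma all_action_iff: "(\<forall>a. P a) \<longleftrightarrow> P Stop \<and> P Continue"
  by (metis action.exhaust)

lemma sum_UNIV_action: "sum f UNIV = f Stop + f Continue"
  by (simp add: UNIV_action)

lemma sum_UNIV_profile:
  "sum f (UNIV :: profile set) =
     f (Stop, Stop) + f (Stop, Continue) + f (Continue, Stop) + f (Continue, Continue)"
proof -
  have "sum f UNIV = (\<Sum>a\<in>UNIV. \<Sum>b\<in>UNIV. f (a, b))"
    by (simp add: sum.cartesian_product)
  then show ?thesis by (simp add: sum_UNIV_action add.assoc)
qed

lemma pmf_profile_sum:
  "pmf p (Stop, Stop) + pmf p (Stop, Continue) + pmf p (Continue, Stop) + pmf p (Continue, Continue) = 1"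
  using sum_pmf_eq_1[of UNIV p] by (simp add: sum_UNIV_profile)

lemma expectation_profile:
  fixes f :: "profile \<Rightarrow> real"
  shows "measure_pmf.expectation p f =
     pmf p (Stop, Stop) * f (Stop, Stop) + pmf p (Stop, Continue) * f (Stop, Continue) +
     pmf p (Continue, Stop) * f (Continue, Stop) + pmf p (Continue, Continue) * f (Continue, Continue)"
  by (subst integral_measure_pmf_real[where A = UNIV]) (simp_all add: sum_UNIV_profile mult.commute)

lemma pmf_eq_return_pmf_iff: "p = return_pmf a \<longleftrightarrow> pmf p a = 1"
proof
  assume "pmf p a = 1"
  then have "AE x in measure_pmf p. x \<in> {a}"
    using measure_pmf.AE_prob_1[of p "{a}"] by (simp add: measure_pmf_single)
  then show "p = return_pmf a"
    by (simp add: AE_measure_pmf_iff set_pmf_subset_singleton[symmetric] subset_iff)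
qed simp

text \<open>One inequality for each genuine deviation of each player. The factor 2 clears the fair
  coin of (s,s): against an opponent who stops, stopping instead of continuing changes the payoff by
  \<open>(x - u) / 2\<close>.\<close>

lemma correlated_equilibrium_stage_game_iff:
  fixes n :: nat and p :: "profile pmf"
  defines "u \<equiv> lone_value (n - 1)"
    and "ss \<equiv> pmf p (Stop, Stop)" and "sf \<equiv> pmf p (Stop, Continue)"
    and "fs \<equiv> pmf p (Continue, Stop)" and "ff \<equiv> pmf p (Continue, Continue)"
  shows "correlated_equilibrium (stage_game n (v, w) x) p \<longleftrightarrow>
    ss * (u - x) \<le> 2 * sf * (x - v) \<and> 2 * ff * (x - v) \<le> fs * (u - x) \<and>
    ss * (u - x) \<le> 2 * fs * (x - w) \<and> 2 * ff * (x - w) \<le> sf * (u - x)"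
  unfolding correlated_equilibrium_def all_action_iff sum_UNIV_action assms
  by (auto simp: field_simps)

section \<open>Almost-everywhere arguments for the uniform distribution\<close>

lemma prob_space_U01: "prob_space U01"
  by (rule prob_spaceI) (simp add: emeasure_restrict_space space_restrict_space)

interpretation U01: prob_space U01
  by (rule prob_space_U01)

lemma measurable_ident_U01 [measurable]: "(\<lambda>x. x) \<in> borel_measurable U01"
  by (intro measurable_restrict_space1) simp

lemma measure_U01: "measure U01 {0..1} = 1"
  by (simp add: measure_restrict_space)

lemma AE_U01: "AE x in U01. x \<in> {0..1}"
  by (simp add: AE_restrict_space_iff)

lemma AE_U01_neq: "AE x in U01. x \<noteq> a"
proof -
  have "AE x in lborel. x \<noteq> a" by (rule AE_lborel_singleton)
  then show ?thesis by (auto simp: AE_restrict_space_iff)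
qed

text \<open>Nonempty open subintervals have positive measure. All strictness arguments end here: an
  almost sure equality is refuted at one point of a suitable interval.\<close>

lemma AE_U01_interval_witness:
  assumes "AE x in U01. P x" "0 \<le> a" "a < b" "b \<le> 1"
  shows "\<exists>x. a < x \<and> x < b \<and> P x"
proof (rule ccontr)
  assume *: "\<not> ?thesis"
  then have "AE x in U01. x \<notin> {a<..<b}"
    by (intro eventually_mono[OF assms(1)]) auto
  moreover have "{a<..<b} \<in> sets U01" "{x \<in> space U01. \<not> x \<notin> {a<..<b}} = {a<..<b}"
    using assms by (auto simp: sets_restrict_space space_restrict_space)
  ultimately have "emeasure U01 {a<..<b} = 0"
    using AE_iff_measurable[of "{a<..<b}" U01 "\<lambda>x. x \<notin> {a<..<b}"] by simp
  then show False
    using assms by (simp add: emeasure_restrict_space greaterThanLessThan_subseteq_atLeastAtMost_iff)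
qed

text \<open>The source of all uniqueness claims: a strategy that reaches the integral of a pointwise
  bound meets that bound almost everywhere.\<close>

lemma integral_eq_imp_AE_eq:
  fixes f g :: "'a \<Rightarrow> real"
  assumes "integrable M f" "integrable M g" "AE x in M. f x \<le> g x"
    "integral\<^sup>L M g \<le> integral\<^sup>L M f"
  shows "AE x in M. f x = g x"
proof -
  have int: "integrable M (\<lambda>x. g x - f x)" and nonneg: "AE x in M. 0 \<le> g x - f x"
    using assms by auto
  have "integral\<^sup>L M f \<le> integral\<^sup>L M g"
    using assms by (intro integral_mono_AE) auto
  then have "(\<integral>x. g x - f x \<partial>M) = 0"
    using assms by simp
  then have "AE x in M. g x - f x = 0"
    using integral_nonneg_eq_0_iff_AE[OF int nonneg] by simp
  then show ?thesis by auto
qed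

text \<open>The shape taken by an equilibrium inequality when the recommended action is strictly
  dominated: \<open>a\<close> and \<open>b\<close> are the probabilities of the two profiles
  containing it.\<close>

lemma nonneg_combination_zero:
  fixes a b s t :: real
  assumes "a * s + b * t \<le> 0" "0 \<le> a" "0 \<le> b" "0 < s" "0 < t"
  shows "a = 0 \<and> b = 0"
proof -
  have "0 \<le> a * s" "0 \<le> b * t" using assms by auto
  with assms(1) have "a * s = 0" "b * t = 0" by linarith+
  with assms show ?thesis by auto
qed

section \<open>Pointwise payoffs and the exchange of the players\<close>

text \<open>The integrand of \<open>stage_value\<close>, isolated so that strategies can be compared
  at each \<open>x\<close>.\<close>

definition payoff :: "nat \<Rightarrow> real \<times> real \<Rightarrow> real \<Rightarrow> profile pmf \<Rightarrow> real \<times> real" where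
  "payoff n vw x p =
     (measure_pmf.expectation p (\<lambda>a. fst (stage_game n vw x a)),
      measure_pmf.expectation p (\<lambda>a. snd (stage_game n vw x a)))"

lemma stage_value_eq_payoff:
  "stage_value n vw \<mu> = ((LINT x|U01. fst (payoff n vw x (\<mu> x))), (LINT x|U01. snd (payoff n vw x (\<mu> x))))"
  by (simp add: stage_value_def payoff_def)

lemma payoff_return: "payoff n vw x (return_pmf a) = stage_game n vw x a"
  by (simp add: payoff_def)

lemma fst_payoff:
  "fst (payoff n vw x p) =
     pmf p (Stop, Stop) * ((x + lone_value (n - 1)) / 2) + pmf p (Stop, Continue) * x +
     pmf p (Continue, Stop) * lone_value (n - 1) + pmf p (Continue, Continue) * fst vw"
  by (simp add: payoff_def expectation_profile)

lemma snd_payoff: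
  "snd (payoff n vw x p) =
     pmf p (Stop, Stop) * ((x + lone_value (n - 1)) / 2) + pmf p (Stop, Continue) * lone_value (n - 1) +
     pmf p (Continue, Stop) * x + pmf p (Continue, Continue) * snd vw"
  by (simp add: payoff_def expectation_profile)

text \<open>The stage game is symmetric up to exchanging the continuation values, so every fact
  about one player transfers to the other.\<close>

lemma payoff_swap: "payoff n (prod.swap vw) x (map_pmf prod.swap p) = prod.swap (payoff n vw x p)"
proof -
  have "stage_game n (prod.swap vw) x (prod.swap a) = prod.swap (stage_game n vw x a)" for a
    by (cases "(n, vw, x, a)" rule: stage_game.cases) auto
  then show ?thesis by (simp add: payoff_def)
qed

lemma pmf_map_swap: "pmf (map_pmf prod.swap p) (a, b) = pmf p (b, a)"
  using pmf_map_inj'[of prod.swap p "(b, a)"] by simp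

lemma correlated_equilibrium_swap:
  "correlated_equilibrium (stage_game n (prod.swap vw) x) (map_pmf prod.swap p) \<longleftrightarrow>
   correlated_equilibrium (stage_game n vw x) p"
  by (cases vw) (auto simp: correlated_equilibrium_stage_game_iff pmf_map_swap)

definition measurable_strategy :: "stage_strategy \<Rightarrow> bool" where
  "measurable_strategy \<mu> \<longleftrightarrow> (\<forall>a. (\<lambda>x. pmf (\<mu> x) a) \<in> borel_measurable U01)"

lemma measurable_payoff:
  assumes "measurable_strategy \<mu>"
  shows "(\<lambda>x. fst (payoff n vw x (\<mu> x))) \<in> borel_measurable U01"
    and "(\<lambda>x. snd (payoff n vw x (\<mu> x))) \<in> borel_measurable U01"
proof -
  have [measurable]: "(\<lambda>x. pmf (\<mu> x) a) \<in> borel_measurable U01" for a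
    using assms unfolding measurable_strategy_def by blast
  show "(\<lambda>x. fst (payoff n vw x (\<mu> x))) \<in> borel_measurable U01"
    "(\<lambda>x. snd (payoff n vw x (\<mu> x))) \<in> borel_measurable U01"
    unfolding fst_payoff snd_payoff by measurable
qed

lemma integrable_U01_bounded:
  fixes f :: "real \<Rightarrow> real"
  assumes "f \<in> borel_measurable U01" "\<And>x. x \<in> {0..1} \<Longrightarrow> \<bar>f x\<bar> \<le> B"
  shows "integrable U01 f"
  using AE_U01 assms by (intro U01.integrable_const_bound[of _ B]) (auto elim: eventually_mono)

lemma abs_pmf_mult_le: "\<bar>y\<bar> \<le> B \<Longrightarrow> \<bar>pmf p a * y\<bar> \<le> B"
  by (metis abs_ge_zero abs_mult abs_of_nonneg mult_left_le_one_le order_trans pmf_le_1 pmf_nonneg)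

lemma integrable_payoff:
  assumes "measurable_strategy \<mu>"
  shows "integrable U01 (\<lambda>x. fst (payoff n vw x (\<mu> x)))"
    and "integrable U01 (\<lambda>x. snd (payoff n vw x (\<mu> x)))"
proof -
  \<comment> \<open>\<open>B\<close> dominates every entry of the bimatrix; four entries weighted by
    probabilities give the bound \<open>4 * B\<close>.\<close>
  define B where "B = 1 + \<bar>lone_value (n - 1)\<bar> + \<bar>fst vw\<bar> + \<bar>snd vw\<bar>"
  have "\<bar>fst (payoff n vw x p)\<bar> \<le> 4 * B \<and> \<bar>snd (payoff n vw x p)\<bar> \<le> 4 * B"
    if "x \<in> {0..1}" for x p
  proof -
    have le: "\<bar>x\<bar> \<le> B" "\<bar>(x + lone_value (n - 1)) / 2\<bar> \<le> B" "\<bar>lone_value (n - 1)\<bar> \<le> B"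
      "\<bar>fst vw\<bar> \<le> B" "\<bar>snd vw\<bar> \<le> B"
      using that by (auto simp: B_def)
    have abs_sum_le: "\<bar>a + b + c + d\<bar> \<le> 4 * B"
      if "\<bar>a\<bar> \<le> B" "\<bar>b\<bar> \<le> B" "\<bar>c\<bar> \<le> B" "\<bar>d\<bar> \<le> B" for a b c d :: real
      using that by linarith
    show ?thesis
      unfolding fst_payoff snd_payoff
      by (intro conjI abs_sum_le abs_pmf_mult_le le)
  qed
  then show "integrable U01 (\<lambda>x. fst (payoff n vw x (\<mu> x)))"
    "integrable U01 (\<lambda>x. snd (payoff n vw x (\<mu> x)))"
    by (intro integrable_U01_bounded[where B = "4 * B"] measurable_payoff assms; blast)+
qed

section \<open>The lone searcher and the stage equilibrium favouring Player 1\<close>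

text \<open>Since \<open>max x u\<close> is at least \<open>u\<close>, the values never decrease and
  stay positive. A value of 1 would force \<open>max x u = 1\<close> almost everywhere, which fails
  on (0,1) as long as \<open>u < 1\<close>.\<close>

lemma lone_value_bounds:
  assumes "1 \<le> n"
  shows "0 < lone_value n \<and> lone_value n < 1"
  using assms
proof (induction n rule: dec_induct)
  case base
  show ?case by simp
next
  case (step n)
  let ?u = "lone_value n"
  have eq: "lone_value (Suc n) = (LINT x|U01. max x ?u)"
    using step.hyps by (cases n) auto
  have int: "integrable U01 (\<lambda>x. max x ?u)"
    using step.IH by (intro integrable_U01_bounded[where B = 1]) auto
  have "?u = (LINT x|U01. ?u)" by (simp add: measure_U01)
  also have "\<dots> \<le> (LINT x|U01. max x ?u)"
    by (intro integral_mono int) auto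
  finally have "?u \<le> lone_value (Suc n)" by (simp add: eq)
  moreover have "\<not> 1 \<le> lone_value (Suc n)"
  proof
    assume "1 \<le> lone_value (Suc n)"
    then have "AE x in U01. max x ?u = 1"
      using AE_U01 step.IH
      by (intro integral_eq_imp_AE_eq int)
         (auto simp: eq measure_U01 elim!: eventually_mono)
    from AE_U01_interval_witness[OF this, of 0 1] step.IH show False by auto
  qed
  ultimately show ?case using step.IH by linarith
qed

text \<open>The action is forced up to a null set, except on the tie region, where only Player 2 makes an offer.\<close>

definition favoring1 :: "nat \<Rightarrow> real \<times> real \<Rightarrow> stage_strategy" where
  "favoring1 n vw x = return_pmf
     (if x < min (fst vw) (snd vw) then (Continue, Continue)
      else if lone_value (n - 1) \<le> x then (Stop, Stop)
      else if x < snd vw then (Stop, Continue) else (Continue, Stop))"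

lemma measurable_favoring1: "measurable_strategy (favoring1 n vw)"
  unfolding measurable_strategy_def
proof
  fix a
  have "(\<lambda>x. pmf (favoring1 n vw x) a) =
    (\<lambda>x. if x < min (fst vw) (snd vw) then indicator {(Continue, Continue)} a
      else if lone_value (n - 1) \<le> x then indicator {(Stop, Stop)} a
      else if x < snd vw then indicator {(Stop, Continue)} a else indicator {(Continue, Stop)} a)"
    by (auto simp: favoring1_def fun_eq_iff indicator_def)
  then show "(\<lambda>x. pmf (favoring1 n vw x) a) \<in> borel_measurable U01"
    by simp
qed

lemma stage_equilibriumD:
  assumes "stage_equilibrium n vw \<mu>"
  shows "measurable_strategy \<mu>" "x \<in> {0..1} \<Longrightarrow> correlated_equilibrium (stage_game n vw x) (\<mu> x)"
  using assms by (auto simp: stage_equilibrium_def measurable_strategy_def)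

lemma stage_equilibrium_swap:
  assumes "stage_equilibrium n vw \<mu>"
  shows "stage_equilibrium n (prod.swap vw) (\<lambda>x. map_pmf prod.swap (\<mu> x))"
proof -
  have "(\<lambda>x. pmf (map_pmf prod.swap (\<mu> x)) (a, b)) \<in> borel_measurable U01" for a b
    using assms unfolding stage_equilibrium_def pmf_map_swap by blast
  then show ?thesis
    using assms by (simp add: stage_equilibrium_def correlated_equilibrium_swap split_paired_all)
qed

lemma stage_value_swap:
  "stage_value n (prod.swap vw) (\<lambda>x. map_pmf prod.swap (\<mu> x)) = prod.swap (stage_value n vw \<mu>)"
  by (simp add: stage_value_eq_payoff payoff_swap)

lemma stage_value_cong_AE:
  assumes "measurable_strategy \<mu>" "measurable_strategy \<nu>" "AE x in U01. \<mu> x = \<nu> x"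
  shows "stage_value n vw \<mu> = stage_value n vw \<nu>"
  unfolding stage_value_eq_payoff prod.inject
  using assms(3) by (intro conjI integral_cong_AE measurable_payoff assms(1,2)) (auto elim: eventually_mono)

lemma total_stage_value:
  assumes "measurable_strategy \<nu>"
  shows "total (stage_value n vw \<nu>) = (LINT x|U01. total (payoff n vw x (\<nu> x)))"
    and "integrable U01 (\<lambda>x. total (payoff n vw x (\<nu> x)))"
  using integrable_payoff[OF assms] by (simp_all add: total_def stage_value_eq_payoff)

section \<open>The lower bound for the less favoured player\<close>

text \<open>For \<open>m < u\<close> this is what Player 2 receives under \<open>favoring1\<close>
  when \<open>m\<close> is Player 2's continuation value and Player 1's is at least as
  large.\<close>

definition least_payoff :: "nat \<Rightarrow> real \<Rightarrow> real \<Rightarrow> real" where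
  "least_payoff n m x =
     (if lone_value (n - 1) \<le> x then (x + lone_value (n - 1)) / 2 else max x m)"

definition least_value :: "nat \<Rightarrow> real \<Rightarrow> real" where
  "least_value n m = (LINT x|U01. least_payoff n m x)"

lemma integrable_least_payoff: "integrable U01 (least_payoff n m)"
proof (rule integrable_U01_bounded)
  show "least_payoff n m \<in> borel_measurable U01"
    unfolding least_payoff_def[abs_def] by measurable
  show "\<bar>least_payoff n m x\<bar> \<le> 1 + \<bar>m\<bar> + \<bar>lone_value (n - 1)\<bar>" if "x \<in> {0..1}" for x
    using that by (auto simp: least_payoff_def)
qed

text \<open>The integrand is nonnegative even for negative \<open>m\<close>, because
  \<open>max x m\<close> is at least \<open>x\<close>, and it is positive above \<open>u\<close>,
  where \<open>u < 1\<close>.\<close>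

lemma least_value_pos:
  assumes "2 \<le> n"
  shows "0 < least_value n m"
proof (rule ccontr)
  let ?u = "lone_value (n - 1)"
  assume "\<not> ?thesis"
  then have "integral\<^sup>L U01 (least_payoff n m) \<le> (LINT x|U01. 0)"
    by (simp add: least_value_def)
  moreover have u: "0 < ?u" "?u < 1"
    using lone_value_bounds[of "n - 1"] assms by auto
  moreover have "AE x in U01. 0 \<le> least_payoff n m x"
    using AE_U01 by eventually_elim (use u in \<open>auto simp: least_payoff_def\<close>)
  ultimately have "AE x in U01. 0 = least_payoff n m x"
    by (intro integral_eq_imp_AE_eq integrable_least_payoff) auto
  from AE_U01_interval_witness[OF this, of ?u 1] u show False
    by (auto simp: least_payoff_def)
qed

lemma least_value_mono:
  assumes "m \<le> m'"
  shows "least_value n m \<le> least_value n m'"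
  unfolding least_value_def
  by (intro integral_mono integrable_least_payoff) (use assms in \<open>auto simp: least_payoff_def\<close>)

text \<open>On the interval from \<open>m\<close> to \<open>m'\<close> the integrands are
  \<open>x\<close> and \<open>m'\<close>, and this interval lies in [0,1] because
  \<open>0 \<le> m\<close> and \<open>m' < u\<close>.\<close>

lemma least_value_inj:
  assumes "2 \<le> n" "0 \<le> m" "m \<le> m'" "m' < lone_value (n - 1)" "least_value n m' \<le> least_value n m"
  shows "m = m'"
proof (rule ccontr)
  assume "m \<noteq> m'"
  have "lone_value (n - 1) < 1"
    using lone_value_bounds[of "n - 1"] assms(1) by auto
  have "least_payoff n m x \<le> least_payoff n m' x" for x
    using assms(3) by (auto simp: least_payoff_def)
  then have "AE x in U01. least_payoff n m x = least_payoff n m' x"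
    using assms(5) unfolding least_value_def
    by (intro integral_eq_imp_AE_eq integrable_least_payoff) auto
  from AE_U01_interval_witness[OF this, of m m'] show False
    using assms \<open>m \<noteq> m'\<close> \<open>lone_value (n - 1) < 1\<close> by (auto simp: least_payoff_def)
qed

section \<open>Payoffs and forced actions at a single stage\<close>

text \<open>Continuation values below the lone value are an invariant of all game equilibria
  (\<open>value_less_lone_value\<close>), so every stage reached in play is an instance.\<close>

locale stage =
  fixes n :: nat and v w :: real
  assumes two_le_n: "2 \<le> n" and v_less: "v < lone_value (n - 1)" and w_less: "w < lone_value (n - 1)"
begin

abbreviation "u \<equiv> lone_value (n - 1)"

abbreviation "tie x \<equiv> max v w < x \<and> x < u"

lemma swapped: "stage n w v"
  using two_le_n v_less w_less by unfold_locales

lemma u_bounds: "0 < u" "u < 1"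
  using lone_value_bounds[of "n - 1"] two_le_n by auto

lemma correlated_equilibrium_iff:
  "correlated_equilibrium (stage_game n (v, w) x) p \<longleftrightarrow>
    pmf p (Stop, Stop) * (u - x) \<le> 2 * pmf p (Stop, Continue) * (x - v) \<and>
    2 * pmf p (Continue, Continue) * (x - v) \<le> pmf p (Continue, Stop) * (u - x) \<and>
    pmf p (Stop, Stop) * (u - x) \<le> 2 * pmf p (Continue, Stop) * (x - w) \<and>
    2 * pmf p (Continue, Continue) * (x - w) \<le> pmf p (Stop, Continue) * (u - x)"
  by (rule correlated_equilibrium_stage_game_iff)

text \<open>Equilibrium is required at every \<open>x\<close>, not just almost every
  \<open>x\<close>. At the boundary points \<open>u\<close>, \<open>v\<close>, \<open>w\<close> the
  prescribed action still satisfies the inequalities, some of them with equality.\<close>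

lemma favoring1_equilibrium: "stage_equilibrium n (v, w) (favoring1 n (v, w))"
proof -
  have "correlated_equilibrium (stage_game n (v, w) x) (favoring1 n (v, w) x)" for x
    using v_less w_less unfolding correlated_equilibrium_iff by (simp add: favoring1_def)
  then show ?thesis
    using measurable_favoring1 by (auto simp: stage_equilibrium_def measurable_strategy_def)
qed

text \<open>Above \<open>u\<close> stopping is strictly dominant for both players, below
  \<open>min v w\<close> continuing is. Between \<open>v\<close> and \<open>w\<close> only the
  player with the larger continuation value has a dominant action, namely to continue, and the
  other's unique best reply is to stop.\<close>

lemma forced_action:
  assumes "correlated_equilibrium (stage_game n (v, w) x) p" "x \<noteq> u" "x \<noteq> v" "x \<noteq> w" "\<not> tie x"
  shows "p = favoring1 n (v, w) x"
proof -
  note ce = assms(1)[unfolded correlated_equilibrium_iff]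
  note sum = pmf_profile_sum[of p]
  note nonneg = pmf_nonneg[of p]
  consider "u < x" | "x < min v w" | "v < x" "x < w" | "w < x" "x < v"
    using assms(2-5) by linarith
  then show ?thesis
  proof cases
    case 1
    have "pmf p (Continue, Continue) = 0 \<and> pmf p (Continue, Stop) = 0"
      using ce 1 v_less
      by (intro nonneg_combination_zero[where s = "2 * (x - v)" and t = "x - u"])
         (auto simp: algebra_simps)
    moreover have "pmf p (Continue, Continue) = 0 \<and> pmf p (Stop, Continue) = 0"
      using ce 1 w_less
      by (intro nonneg_combination_zero[where s = "2 * (x - w)" and t = "x - u"])
         (auto simp: algebra_simps)
    ultimately have "pmf p (Stop, Stop) = 1" using sum by simp
    then show ?thesis
      using 1 v_less w_less by (simp add: favoring1_def pmf_eq_return_pmf_iff)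
  next
    case 2
    have "pmf p (Stop, Stop) = 0 \<and> pmf p (Stop, Continue) = 0"
      using ce 2 v_less
      by (intro nonneg_combination_zero[where s = "u - x" and t = "2 * (v - x)"])
         (auto simp: algebra_simps)
    moreover have "pmf p (Stop, Stop) = 0 \<and> pmf p (Continue, Stop) = 0"
      using ce 2 v_less
      by (intro nonneg_combination_zero[where s = "u - x" and t = "2 * (w - x)"])
         (auto simp: algebra_simps)
    ultimately have "pmf p (Continue, Continue) = 1" using sum by simp
    then show ?thesis
      using 2 by (simp add: favoring1_def pmf_eq_return_pmf_iff)
  next
    case 3
    have eq: "pmf p (Stop, Stop) = 0 \<and> pmf p (Continue, Stop) = 0"
      using ce 3 w_less
      by (intro nonneg_combination_zero[where s = "u - x" and t = "2 * (w - x)"])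
         (auto simp: algebra_simps)
    then have "pmf p (Continue, Continue) * (x - v) \<le> 0"
      using ce by (simp add: mult.commute)
    then have "pmf p (Continue, Continue) = 0"
      using 3 nonneg[of "(Continue, Continue)"] by (simp add: mult_le_0_iff)
    with eq have "pmf p (Stop, Continue) = 1" using sum by simp
    then show ?thesis
      using 3 w_less by (simp add: favoring1_def pmf_eq_return_pmf_iff)
  next
    case 4
    have eq: "pmf p (Stop, Stop) = 0 \<and> pmf p (Stop, Continue) = 0"
      using ce 4 v_less
      by (intro nonneg_combination_zero[where s = "u - x" and t = "2 * (v - x)"])
         (auto simp: algebra_simps)
    then have "pmf p (Continue, Continue) * (x - w) \<le> 0"
      using ce by (simp add: mult.commute)
    then have "pmf p (Continue, Continue) = 0"
      using 4 nonneg[of "(Continue, Continue)"] by (simp add: mult_le_0_iff)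
    with eq have "pmf p (Continue, Stop) = 1" using sum by simp
    then show ?thesis
      using 4 v_less by (simp add: favoring1_def pmf_eq_return_pmf_iff)
  qed
qed

lemma payoff_favoring1:
  "payoff n (v, w) x (favoring1 n (v, w) x) =
     (if x < min v w then (v, w) else if u \<le> x then ((x + u) / 2, (x + u) / 2)
      else if x < w then (x, u) else (u, x))"
  by (simp add: favoring1_def payoff_return)

lemma total_payoff_favoring1:
  "total (payoff n (v, w) x (favoring1 n (v, w) x)) = (if x < min v w then v + w else x + u)"
  by (auto simp: total_def payoff_favoring1)

lemma favoring1_tie: "tie x \<Longrightarrow> favoring1 n (v, w) x = return_pmf (Continue, Stop)"
  by (simp add: favoring1_def)

lemma tie_payoff:
  assumes "tie x"
  shows "fst (payoff n (v, w) x p) \<le> u"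
    and "fst (payoff n (v, w) x p) = u \<Longrightarrow> p = favoring1 n (v, w) x"
    and "total (payoff n (v, w) x p) \<le> x + u"
    and "total (payoff n (v, w) x p) = x + u \<Longrightarrow> pmf p (Continue, Continue) = 0"
    and "pmf p (Continue, Continue) = 0 \<Longrightarrow> x \<le> snd (payoff n (v, w) x p)"
    and "pmf p (Continue, Continue) = 0 \<Longrightarrow> snd (payoff n (v, w) x p) = x \<Longrightarrow> p = favoring1 n (v, w) x"
proof -
  note sum = pmf_profile_sum[of p]
  \<comment> \<open>Eliminating the probability of (f,s) writes each distance to a bound as a
    combination of the other three probabilities with nonnegative coefficients. Signs give the
    bounds, vanishing terms the equality cases.\<close>
  have fs: "pmf p (Continue, Stop) =
      1 - pmf p (Stop, Stop) - pmf p (Stop, Continue) - pmf p (Continue, Continue)"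
    using sum by simp
  have pos: "0 < u - x" "0 < u - v" "0 < x + u - v - w"
    using assms v_less w_less by auto
  have nonneg: "0 \<le> pmf p (Stop, Stop) * (u - x)" "0 \<le> pmf p (Stop, Continue) * (u - x)"
    "0 \<le> pmf p (Continue, Continue) * (u - v)" "0 \<le> pmf p (Continue, Continue) * (x + u - v - w)"
    using pos by auto
  have gap1: "u - fst (payoff n (v, w) x p) =
      pmf p (Stop, Stop) * (u - x) / 2 + pmf p (Stop, Continue) * (u - x) +
      pmf p (Continue, Continue) * (u - v)"
    unfolding fst_payoff fs by (simp add: field_simps)
  have gap: "x + u - total (payoff n (v, w) x p) = pmf p (Continue, Continue) * (x + u - v - w)"
    unfolding total_def fst_payoff snd_payoff fs by (simp add: field_simps)
  have gap2: "snd (payoff n (v, w) x p) - x =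
      pmf p (Stop, Stop) * (u - x) / 2 + pmf p (Stop, Continue) * (u - x)"
    if "pmf p (Continue, Continue) = 0"
    using that unfolding snd_payoff fs by (simp add: field_simps)
  show "fst (payoff n (v, w) x p) \<le> u" "total (payoff n (v, w) x p) \<le> x + u"
    using gap1 gap nonneg by linarith+
  show "x \<le> snd (payoff n (v, w) x p)" if "pmf p (Continue, Continue) = 0"
    using gap2[OF that] nonneg by linarith
  show "pmf p (Continue, Continue) = 0" if "total (payoff n (v, w) x p) = x + u"
    using gap that pos by auto
  have *: "p = favoring1 n (v, w) x"
    if "pmf p (Stop, Stop) * (u - x) = 0" "pmf p (Stop, Continue) * (u - x) = 0"
      "pmf p (Continue, Continue) = 0"
    using that pos fs unfolding favoring1_tie[OF assms] pmf_eq_return_pmf_iff by simp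
  show "p = favoring1 n (v, w) x" if "fst (payoff n (v, w) x p) = u"
  proof (rule *)
    have "pmf p (Continue, Continue) * (u - v) = 0"
      using gap1 nonneg that by linarith
    then show "pmf p (Continue, Continue) = 0" using pos by simp
  qed (use gap1 nonneg that in linarith)+
  show "p = favoring1 n (v, w) x"
    if "pmf p (Continue, Continue) = 0" "snd (payoff n (v, w) x p) = x"
    by (rule *) (use gap2 nonneg that in linarith)+
qed

end

section \<open>An arbitrary equilibrium compared with the favouring one\<close>

locale stage_play = stage +
  fixes \<mu> :: stage_strategy
  assumes equilibrium: "stage_equilibrium n (v, w) \<mu>"
begin

lemma measurable: "measurable_strategy \<mu>"
  using equilibrium by (rule stage_equilibriumD)

lemma AE_forced: "AE x in U01. tie x \<or> \<mu> x = favoring1 n (v, w) x"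
  using AE_U01 AE_U01_neq[of u] AE_U01_neq[of v] AE_U01_neq[of w]
proof eventually_elim
  case (elim x)
  then show ?case
    using forced_action[of x "\<mu> x"] stage_equilibriumD(2)[OF equilibrium, of x] by auto
qed

lemma fst_payoff_le: "AE x in U01. fst (payoff n (v, w) x (\<mu> x)) \<le> fst (payoff n (v, w) x (favoring1 n (v, w) x))"
  using AE_forced
proof eventually_elim
  case (elim x)
  then show ?case
    using tie_payoff(1)[of x "\<mu> x"] by (auto simp: payoff_favoring1)
qed

lemma total_payoff_le:
  "AE x in U01. total (payoff n (v, w) x (\<mu> x)) \<le> total (payoff n (v, w) x (favoring1 n (v, w) x))"
  using AE_forced
proof eventually_elim
  case (elim x)
  then show ?case
    using tie_payoff(3)[of x "\<mu> x"] by (auto simp: payoff_favoring1 total_def)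
qed

lemma fst_stage_value_le: "fst (stage_value n (v, w) \<mu>) \<le> fst (stage_value n (v, w) (favoring1 n (v, w)))"
  unfolding stage_value_eq_payoff fst_conv
  by (intro integral_mono_AE integrable_payoff measurable measurable_favoring1 fst_payoff_le)

text \<open>Uniqueness of the libertarian 1 choice: optimality in the integral makes the pointwise
  bound tight, and on ties only (f,s) attains it.\<close>

lemma AE_eq_favoring1I:
  assumes "fst (stage_value n (v, w) (favoring1 n (v, w))) \<le> fst (stage_value n (v, w) \<mu>)"
  shows "AE x in U01. \<mu> x = favoring1 n (v, w) x"
proof -
  have "AE x in U01. fst (payoff n (v, w) x (\<mu> x)) = fst (payoff n (v, w) x (favoring1 n (v, w) x))"
    using assms unfolding stage_value_eq_payoff fst_conv
    by (intro integral_eq_imp_AE_eq integrable_payoff measurable measurable_favoring1 fst_payoff_le)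
  then show ?thesis
    using AE_forced
  proof eventually_elim
    case (elim x)
    then show ?case
      using tie_payoff(2)[of x "\<mu> x"] by (auto simp: payoff_favoring1)
  qed
qed

lemma total_stage_value_le:
  "total (stage_value n (v, w) \<mu>) \<le> total (stage_value n (v, w) (favoring1 n (v, w)))"
  unfolding total_stage_value(1)[OF measurable] total_stage_value(1)[OF measurable_favoring1]
  by (intro integral_mono_AE total_stage_value measurable measurable_favoring1 total_payoff_le)

lemma AE_tie_no_continue:
  assumes "total (stage_value n (v, w) (favoring1 n (v, w))) \<le> total (stage_value n (v, w) \<mu>)"
  shows "AE x in U01. tie x \<longrightarrow> pmf (\<mu> x) (Continue, Continue) = 0"
proof -
  have "AE x in U01. total (payoff n (v, w) x (\<mu> x)) = total (payoff n (v, w) x (favoring1 n (v, w) x))"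
    using assms
    unfolding total_stage_value(1)[OF measurable] total_stage_value(1)[OF measurable_favoring1]
    by (intro integral_eq_imp_AE_eq total_stage_value measurable measurable_favoring1 total_payoff_le)
  then show ?thesis
  proof eventually_elim
    case (elim x)
    then show ?case
      using tie_payoff(4)[of x "\<mu> x"] by (auto simp: payoff_favoring1 total_def)
  qed
qed

text \<open>On ties without (f,f) Player 2 gets at least \<open>x\<close>. Elsewhere the action is
  forced, and the bound is read off from it.\<close>

lemma AE_least_payoff_le:
  assumes "AE x in U01. tie x \<longrightarrow> pmf (\<mu> x) (Continue, Continue) = 0"
  shows "AE x in U01. least_payoff n (min v w) x \<le> snd (payoff n (v, w) x (\<mu> x))"
  using AE_forced assms
proof eventually_elim
  case (elim x)
  show ?case
  proof (cases "tie x")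
    case True
    then show ?thesis
      using elim tie_payoff(5)[OF True, of "\<mu> x"] by (auto simp: least_payoff_def)
  next
    case False
    then show ?thesis
      using elim v_less w_less by (auto simp: least_payoff_def payoff_favoring1)
  qed
qed

lemma least_value_le_snd:
  assumes "AE x in U01. tie x \<longrightarrow> pmf (\<mu> x) (Continue, Continue) = 0"
  shows "least_value n (min v w) \<le> snd (stage_value n (v, w) \<mu>)"
  unfolding stage_value_eq_payoff least_value_def snd_conv
  by (intro integral_mono_AE integrable_payoff integrable_least_payoff measurable
      AE_least_payoff_le assms)

lemma snd_eq_least_value:
  assumes no_cont: "AE x in U01. tie x \<longrightarrow> pmf (\<mu> x) (Continue, Continue) = 0"
    and le: "snd (stage_value n (v, w) \<mu>) \<le> least_value n (min v w)"
  shows "AE x in U01. \<mu> x = favoring1 n (v, w) x" and "0 \<le> v \<Longrightarrow> w \<le> v"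
proof -
  have *: "AE x in U01. least_payoff n (min v w) x = snd (payoff n (v, w) x (\<mu> x))"
    using le unfolding stage_value_eq_payoff least_value_def snd_conv
    by (intro integral_eq_imp_AE_eq integrable_payoff integrable_least_payoff measurable
        AE_least_payoff_le no_cont)
  show eq: "AE x in U01. \<mu> x = favoring1 n (v, w) x"
    using AE_forced no_cont *
  proof eventually_elim
    case (elim x)
    then show ?case
      using tie_payoff(6)[of x "\<mu> x"] by (auto simp: least_payoff_def)
  qed
  show "w \<le> v" if "0 \<le> v"
  proof (rule ccontr)
    assume "\<not> w \<le> v"
    then have "v < w" by simp
    \<comment> \<open>If \<open>v < w\<close>, then for \<open>x\<close> between them Player 1 makes
      the only offer, so Player 2 gets \<open>u\<close> while the least payoff is
      \<open>x < u\<close>. The hypothesis \<open>0 \<le> v\<close> keeps this interval inside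
      [0,1].\<close>
    have "AE x in U01. least_payoff n (min v w) x = snd (payoff n (v, w) x (favoring1 n (v, w) x))"
      using * eq by eventually_elim simp
    from AE_U01_interval_witness[OF this that \<open>v < w\<close>] obtain x where "v < x" "x < w"
        "least_payoff n (min v w) x = snd (payoff n (v, w) x (favoring1 n (v, w) x))"
      using w_less u_bounds by auto
    then show False
      using w_less by (simp add: least_payoff_def payoff_favoring1)
  qed
qed

text \<open>The lone searcher's payoff \<open>max x u\<close> is a pointwise bound. It is missed for
  \<open>x > u\<close>, where both players make an offer and each gets only
  \<open>(x + u) / 2\<close>.\<close>

lemma fst_stage_value_less: "fst (stage_value n (v, w) \<mu>) < lone_value n"
proof (rule ccontr)
  assume neg: "\<not> ?thesis"
  have lone: "lone_value n = (LINT x|U01. max x u)"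
    using two_le_n by (cases n rule: lone_value.cases) auto
  have int: "integrable U01 (\<lambda>x. max x u)"
    using u_bounds by (intro integrable_U01_bounded[where B = 1]) auto
  have "AE x in U01. fst (payoff n (v, w) x (\<mu> x)) \<le> max x u"
    using AE_forced
  proof eventually_elim
    case (elim x)
    then show ?case
      using tie_payoff(1)[of x "\<mu> x"] v_less by (auto simp: payoff_favoring1)
  qed
  then have "AE x in U01. fst (payoff n (v, w) x (\<mu> x)) = max x u"
    using neg unfolding lone stage_value_eq_payoff fst_conv
    by (intro integral_eq_imp_AE_eq integrable_payoff measurable int) auto
  with AE_forced have
    "AE x in U01. (tie x \<or> \<mu> x = favoring1 n (v, w) x) \<and> fst (payoff n (v, w) x (\<mu> x)) = max x u"
    by eventually_elim simp
  from AE_U01_interval_witness[OF this, of u 1] obtain x where "u < x" "\<mu> x = favoring1 n (v, w) x"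
      "fst (payoff n (v, w) x (\<mu> x)) = max x u"
    using u_bounds by auto
  then show False
    using v_less w_less by (simp add: payoff_favoring1)
qed

end

section \<open>Consequences of exchanging the players, and comparison of totals\<close>

context stage
begin

lemma swapped_play:
  assumes "stage_equilibrium n (v, w) \<mu>"
  shows "stage_play n w v (\<lambda>x. map_pmf prod.swap (\<mu> x))"
proof -
  interpret swapped: stage n w v by (rule swapped)
  show ?thesis
    using stage_equilibrium_swap[OF assms] by unfold_locales simp
qed

lemma stage_value_swapped:
  "stage_value n (w, v) (\<lambda>x. map_pmf prod.swap (\<mu> x)) = prod.swap (stage_value n (v, w) \<mu>)"
  using stage_value_swap[of n "(v, w)" \<mu>] by simp

lemma stage_value_less:
  assumes "stage_equilibrium n (v, w) \<mu>"
  shows "fst (stage_value n (v, w) \<mu>) < lone_value n" "snd (stage_value n (v, w) \<mu>) < lone_value n"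
proof -
  interpret stage_play n v w \<mu>
    using assms by unfold_locales
  interpret swapped: stage_play n w v "\<lambda>x. map_pmf prod.swap (\<mu> x)"
    using assms by (rule swapped_play)
  show "fst (stage_value n (v, w) \<mu>) < lone_value n"
    by (rule fst_stage_value_less)
  show "snd (stage_value n (v, w) \<mu>) < lone_value n"
    using swapped.fst_stage_value_less by (simp add: stage_value_swapped)
qed

lemma snd_favoring1:
  assumes "w \<le> v"
  shows "snd (stage_value n (v, w) (favoring1 n (v, w))) = least_value n w"
proof -
  have "snd (payoff n (v, w) x (favoring1 n (v, w) x)) = least_payoff n w x" for x
    using assms v_less w_less by (auto simp: payoff_favoring1 least_payoff_def)
  then show ?thesis by (simp add: stage_value_eq_payoff least_value_def)
qed

lemma favoring1_snd_less_fst: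
  assumes "w \<le> v"
  shows "snd (stage_value n (v, w) (favoring1 n (v, w))) < fst (stage_value n (v, w) (favoring1 n (v, w)))"
proof (rule ccontr)
  assume neg: "\<not> ?thesis"
  have "AE x in U01. snd (payoff n (v, w) x (favoring1 n (v, w) x)) = fst (payoff n (v, w) x (favoring1 n (v, w) x))"
    using neg assms unfolding stage_value_eq_payoff fst_conv snd_conv
    by (intro integral_eq_imp_AE_eq integrable_payoff measurable_favoring1) (auto simp: payoff_favoring1)
  \<comment> \<open>For \<open>x\<close> between \<open>w\<close> and \<open>u\<close> Player 1 gets
    \<open>u\<close> and Player 2 gets \<open>x\<close>; the maximum with 0 is taken because
    \<open>w\<close> may be negative.\<close>
  from AE_U01_interval_witness[OF this, of "max 0 w" u] obtain x
    where "w < x" "x < u"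
      "snd (payoff n (v, w) x (favoring1 n (v, w) x)) = fst (payoff n (v, w) x (favoring1 n (v, w) x))"
    using u_bounds w_less by auto
  then show False using assms by (simp add: payoff_favoring1)
qed

end

text \<open>The total at \<open>x\<close> is the continuation sum below the smaller value and
  \<open>x + u\<close> above it. Lowering the smaller value helps: once \<open>x\<close> reaches
  \<open>min v' w'\<close>, \<open>x + u\<close> exceeds \<open>v' + w'\<close> and hence also
  \<open>v + w\<close>. This gain is strict between the two minima.\<close>

lemma total_favoring1_mono:
  assumes "stage n v w" "stage n v' w'" "min v' w' \<le> min v w" "v + w \<le> v' + w'"
  defines "T \<equiv> total (stage_value n (v, w) (favoring1 n (v, w)))"
    and "T' \<equiv> total (stage_value n (v', w') (favoring1 n (v', w')))"
  shows "T \<le> T'" and "T' \<le> T \<Longrightarrow> 0 \<le> min v' w' \<Longrightarrow> min v w = min v' w'"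
proof -
  interpret a: stage n v w by fact
  interpret b: stage n v' w' by fact
  let ?t = "\<lambda>x. total (payoff n (v, w) x (favoring1 n (v, w) x))"
  let ?t' = "\<lambda>x. total (payoff n (v', w') x (favoring1 n (v', w') x))"
  have le: "?t x \<le> ?t' x" for x
    using assms(3,4) a.v_less a.w_less b.v_less b.w_less
    unfolding a.total_payoff_favoring1 b.total_payoff_favoring1 by (simp split: if_split) linarith
  show "T \<le> T'"
    unfolding T_def T'_def total_stage_value(1)[OF measurable_favoring1]
    by (intro integral_mono total_stage_value measurable_favoring1 le)
  show "min v w = min v' w'" if T: "T' \<le> T" and nonneg: "0 \<le> min v' w'"
  proof (rule ccontr)
    assume "min v w \<noteq> min v' w'"
    then have less: "min v' w' < min v w" using assms(3) by linarith
    have "AE x in U01. ?t x = ?t' x"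
      using T unfolding T_def T'_def total_stage_value(1)[OF measurable_favoring1]
      by (intro integral_eq_imp_AE_eq total_stage_value measurable_favoring1) (use le in auto)
    moreover have "min v w \<le> 1"
      using a.v_less a.u_bounds by linarith
    ultimately obtain x where "min v' w' < x" "x < min v w" "?t x = ?t' x"
      using AE_U01_interval_witness[OF _ nonneg less] by blast
    then have "v + w = x + b.u"
      unfolding a.total_payoff_favoring1 b.total_payoff_favoring1
      by (metis order.asym)
    then show False
      using assms(4) b.v_less b.w_less \<open>min v' w' < x\<close> by linarith
  qed
qed

section \<open>Exchanging the players throughout the game\<close>

definition swap_strategy :: "strategy \<Rightarrow> strategy" where
  "swap_strategy \<pi> = (\<lambda>n x. map_pmf prod.swap (\<pi> n x))"

lemma swap_strategy_swap_strategy: "swap_strategy (swap_strategy \<pi>) = \<pi>"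
  by (simp add: swap_strategy_def map_pmf_comp)

lemma swap_strategy_eq_iff: "swap_strategy \<pi> n x = swap_strategy \<rho> n x \<longleftrightarrow> \<pi> n x = \<rho> n x"
  by (metis swap_strategy_def swap_strategy_swap_strategy)

lemma game_value_step:
  "2 \<le> n \<Longrightarrow> game_value c \<pi> n = stage_value n (game_value c \<pi> (n - 1)) (\<pi> n)"
  by (cases "(c, \<pi>, n)" rule: game_value.cases) auto

lemma game_value_swap: "game_value c (swap_strategy \<pi>) n = prod.swap (game_value c \<pi> n)"
proof (induction c \<pi> n rule: game_value.induct)
  case (3 c \<pi> n)
  then show ?case
    by (simp add: swap_strategy_def stage_value_swap)
qed auto

lemma game_equilibrium_swap:
  "game_equilibrium c N \<pi> \<Longrightarrow> game_equilibrium c N (swap_strategy \<pi>)"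
  unfolding game_equilibrium_def game_value_swap
  by (simp add: swap_strategy_def stage_equilibrium_swap)

lemma selected_by_swap:
  assumes "selected_by f c N \<pi>"
  shows "selected_by (\<lambda>vw. f (prod.swap vw)) c N (swap_strategy \<pi>)"
  unfolding selected_by_def
proof (intro conjI ballI allI impI)
  show "game_equilibrium c N (swap_strategy \<pi>)"
    using assms by (simp add: selected_by_def game_equilibrium_swap)
  fix n \<mu>
  assume n: "n \<in> {2..N}"
    and "stage_equilibrium n (game_value c (swap_strategy \<pi>) (n - 1)) \<mu>"
  then have "stage_equilibrium n (game_value c \<pi> (n - 1)) (\<lambda>x. map_pmf prod.swap (\<mu> x))"
    using stage_equilibrium_swap by (fastforce simp: game_value_swap)
  then have "f (stage_value n (game_value c \<pi> (n - 1)) (\<lambda>x. map_pmf prod.swap (\<mu> x)))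
      \<le> f (game_value c \<pi> n)"
    using assms n by (simp add: selected_by_def)
  then show "f (prod.swap (stage_value n (game_value c (swap_strategy \<pi>) (n - 1)) \<mu>))
      \<le> f (prod.swap (game_value c (swap_strategy \<pi>) n))"
    using stage_value_swap[of n "prod.swap (game_value c \<pi> (n - 1))" \<mu>]
    by (simp add: game_value_swap)
qed

text \<open>Reduces everything about Player 2's criterion to Player 1's.\<close>

lemma libertarian2_iff: "libertarian2 c N \<pi> \<longleftrightarrow> libertarian1 c N (swap_strategy \<pi>)"
  using selected_by_swap[of snd c N \<pi>] selected_by_swap[of fst c N "swap_strategy \<pi>"]
  by (auto simp: libertarian1_def libertarian2_def swap_strategy_swap_strategy)

lemma utilitarian_swap: "utilitarian c N \<pi> \<Longrightarrow> utilitarian c N (swap_strategy \<pi>)"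
  using selected_by_swap[of total c N \<pi>]
  by (simp add: utilitarian_def total_def[abs_def] add.commute)

lemma tie_region_swap: "tie_region c (swap_strategy \<pi>) n = tie_region c \<pi> n"
  by (simp add: tie_region_def game_value_swap max.commute)

section \<open>The strategy favouring Player 1 at every stage\<close>

text \<open>\<open>favoring1\<close> at a stage depends on the values of the very strategy being
  built. Computing the values first avoids this circularity; \<open>game_value_canonical\<close>
  then identifies them with the actual game values.\<close>

fun canonical_value :: "real \<Rightarrow> nat \<Rightarrow> real \<times> real" where
  "canonical_value c 0 = (0, 0)"
| "canonical_value c (Suc 0) = ((1 - 2 * c) / 4, (1 - 2 * c) / 4)"
| "canonical_value c (Suc (Suc n)) =
     stage_value (Suc (Suc n)) (canonical_value c (Suc n))
       (favoring1 (Suc (Suc n)) (canonical_value c (Suc n)))"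

definition canonical :: "real \<Rightarrow> strategy" where
  "canonical c n = favoring1 n (canonical_value c (n - 1))"

lemma game_value_canonical: "game_value c (canonical c) n = canonical_value c n"
  by (induction c n rule: canonical_value.induct) (auto simp: canonical_def)

lemma canonical_eq: "canonical c n = favoring1 n (game_value c (canonical c) (n - 1))"
  by (simp add: canonical_def game_value_canonical)

locale game =
  fixes c :: real
  assumes c_nonneg: "0 \<le> c"
begin

abbreviation "val \<pi> n \<equiv> game_value c \<pi> n"

abbreviation "cval n \<equiv> game_value c (canonical c) n"

lemma stage_of_less:
  assumes "2 \<le> n" "fst (val \<pi> (n - 1)) < lone_value (n - 1)" "snd (val \<pi> (n - 1)) < lone_value (n - 1)"
  shows "stage n (fst (val \<pi> (n - 1))) (snd (val \<pi> (n - 1)))"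
  using assms by unfold_locales

lemma value_less_lone_value:
  assumes "game_equilibrium c N \<pi>" "1 \<le> n" "n \<le> N"
  shows "fst (val \<pi> n) < lone_value n \<and> snd (val \<pi> n) < lone_value n"
  using assms(2,3)
proof (induction n rule: dec_induct)
  case base
  \<comment> \<open>With \<open>c \<ge> 0\<close> the value \<open>(1 - 2 * c) / 4\<close> is at
    most 1/4, below the lone value 1/2.\<close>
  then show ?case using c_nonneg by simp
next
  case (step n)
  interpret stage "Suc n" "fst (val \<pi> n)" "snd (val \<pi> n)"
    using stage_of_less[of "Suc n" \<pi>] step by simp
  have "stage_equilibrium (Suc n) (val \<pi> n) (\<pi> (Suc n))"
    using assms(1)[unfolded game_equilibrium_def, rule_format, of "Suc n"] step by simp
  then show ?case
    using stage_value_less[of "\<pi> (Suc n)"] game_value_step[of "Suc n" c \<pi>] step by simp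
qed

text \<open>The range reaches one stage past \<open>N\<close>, as only the value at
  \<open>n - 1\<close> enters. This lets \<open>canonical_equilibrium\<close> be built up stage by
  stage.\<close>

lemma stageI:
  assumes "game_equilibrium c N \<pi>" "2 \<le> n" "n \<le> Suc N"
  shows "stage n (fst (val \<pi> (n - 1))) (snd (val \<pi> (n - 1)))"
  using assms value_less_lone_value[of N \<pi> "n - 1"] by (intro stage_of_less) auto

lemma stage_playI:
  assumes "game_equilibrium c N \<pi>" "n \<in> {2..N}"
  shows "stage_play n (fst (val \<pi> (n - 1))) (snd (val \<pi> (n - 1))) (\<pi> n)"
  using stageI[OF assms(1), of n] assms
  by (auto simp: stage_play_def stage_play_axioms_def game_equilibrium_def)

lemma canonical_equilibrium: "game_equilibrium c N (canonical c)"
proof (induction N)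
  case 0
  show ?case by (simp add: game_equilibrium_def)
next
  case (Suc N)
  have "stage_equilibrium n (cval (n - 1)) (canonical c n)" if "n \<in> {2..Suc N}" for n
    using stage.favoring1_equilibrium[OF stageI[OF Suc, of n]] that
    by (simp add: canonical_eq[of c n])
  then show ?case by (simp add: game_equilibrium_def)
qed

lemma canonical_stage: "2 \<le> n \<Longrightarrow> stage n (fst (cval (n - 1))) (snd (cval (n - 1)))"
  using stageI[OF canonical_equilibrium, of n n] by simp

lemma canonical_step:
  "2 \<le> n \<Longrightarrow> cval n = stage_value n (cval (n - 1)) (favoring1 n (cval (n - 1)))"
  using game_value_step[of n c "canonical c"] by (simp add: canonical_eq[of c n])

lemma canonical_snd_le_fst: "1 \<le> n \<Longrightarrow> snd (cval n) \<le> fst (cval n) \<and> (2 \<le> n \<longrightarrow> snd (cval n) < fst (cval n))"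
proof (induction n rule: dec_induct)
  case base
  then show ?case by simp
next
  case (step n)
  then show ?case
    using stage.favoring1_snd_less_fst[OF canonical_stage[of "Suc n"]] canonical_step[of "Suc n"]
    by simp
qed

lemma canonical_snd:
  assumes "2 \<le> n"
  shows "snd (cval n) = least_value n (snd (cval (n - 1)))"
  using stage.snd_favoring1[OF canonical_stage[OF assms]] canonical_step[OF assms]
    canonical_snd_le_fst[of "n - 1"] assms by simp

text \<open>Holds even if the stage-one value is negative, and supplies the nonnegativity that the
  strictness arguments ask for.\<close>

lemma canonical_snd_pos: "2 \<le> n \<Longrightarrow> 0 < snd (cval n)"
  using canonical_snd least_value_pos by simp

section \<open>Strategies agreeing almost everywhere with the canonical one\<close>

definition follows_canonical :: "strategy \<Rightarrow> nat \<Rightarrow> bool" where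
  "follows_canonical \<pi> n \<longleftrightarrow> (\<forall>k\<in>{2..n}. AE x in U01. \<pi> k x = canonical c k x)"

lemma follows_canonical_Suc:
  "1 \<le> n \<Longrightarrow> follows_canonical \<pi> (Suc n) \<longleftrightarrow>
    follows_canonical \<pi> n \<and> (AE x in U01. \<pi> (Suc n) x = canonical c (Suc n) x)"
  by (auto simp: follows_canonical_def le_Suc_eq)

lemma follows_canonical_value:
  assumes "game_equilibrium c N \<pi>" "follows_canonical \<pi> n" "n \<le> N"
  shows "val \<pi> n = cval n"
  using assms(2,3)
proof (induction n)
  case 0
  then show ?case by simp
next
  case (Suc n)
  show ?case
  proof (cases "n = 0")
    case False
    then have n: "Suc n \<in> {2..N}" using Suc.prems by simp
    have AE: "AE x in U01. \<pi> (Suc n) x = canonical c (Suc n) x" and IH: "val \<pi> n = cval n"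
      using Suc False by (auto simp: follows_canonical_Suc)
    have "measurable_strategy (\<pi> (Suc n))"
      using stage_play.measurable[OF stage_playI[OF assms(1) n]] .
    moreover have "measurable_strategy (canonical c (Suc n))"
      by (simp add: canonical_eq[of c "Suc n"] measurable_favoring1)
    ultimately show ?thesis
      using stage_value_cong_AE[OF _ _ AE] game_value_step[of "Suc n" c \<pi>]
        game_value_step[of "Suc n" c "canonical c"] n by (simp add: IH)
  qed simp
qed

text \<open>\<open>favoring1\<close> is an admissible competitor at every stage, whatever the
  selection criterion.\<close>

lemma selected_step:
  assumes "selected_by f c N \<pi>" "n \<in> {2..N}"
  shows "f (stage_value n (val \<pi> (n - 1)) (favoring1 n (val \<pi> (n - 1)))) \<le> f (val \<pi> n)"
proof -
  have "stage n (fst (val \<pi> (n - 1))) (snd (val \<pi> (n - 1)))"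
    using assms by (intro stageI[of N]) (auto simp: selected_by_def)
  then show ?thesis
    using assms stage.favoring1_equilibrium[of n "fst (val \<pi> (n - 1))" "snd (val \<pi> (n - 1))"]
    by (simp add: selected_by_def)
qed

lemma selected_play:
  assumes "selected_by f c N \<pi>" "n \<in> {2..N}"
  shows "stage_play n (fst (val \<pi> (n - 1))) (snd (val \<pi> (n - 1))) (\<pi> n)"
  using assms by (intro stage_playI) (auto simp: selected_by_def)

text \<open>Agreement at the earlier-numbered stages gives equal continuation values, hence the same
  stage game, whose libertarian choice is unique almost everywhere.\<close>

lemma libertarian1_follows_canonical:
  assumes "libertarian1 c N \<pi>"
  shows "follows_canonical \<pi> N"
proof -
  have sel: "selected_by fst c N \<pi>"
    using assms by (simp add: libertarian1_def)
  have "n \<le> N \<Longrightarrow> follows_canonical \<pi> n" for n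
  proof (induction n)
    case 0
    then show ?case by (simp add: follows_canonical_def)
  next
    case (Suc n)
    show ?case
    proof (cases "n = 0")
      case True
      then show ?thesis by (simp add: follows_canonical_def)
    next
      case False
      with Suc have n: "Suc n \<in> {2..N}" and IH: "follows_canonical \<pi> n" by auto
      have eq: "val \<pi> n = cval n"
        using sel IH Suc.prems by (intro follows_canonical_value[of N]) (auto simp: selected_by_def)
      have "AE x in U01. \<pi> (Suc n) x = favoring1 (Suc n) (val \<pi> n) x"
        using stage_play.AE_eq_favoring1I[OF selected_play[OF sel n]] selected_step[OF sel n]
          game_value_step[of "Suc n" c \<pi>] n by simp
      then show ?thesis
        using IH False by (simp add: follows_canonical_Suc canonical_eq[of c "Suc n"] eq)
    qed
  qed
  then show ?thesis by simp
qed

lemma stage_value_le_canonical: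
  assumes "2 \<le> n" "stage_equilibrium n (cval (n - 1)) \<mu>"
  shows "fst (stage_value n (cval (n - 1)) \<mu>) \<le> fst (cval n)"
    and "total (stage_value n (cval (n - 1)) \<mu>) \<le> total (cval n)"
proof -
  have "stage_play n (fst (cval (n - 1))) (snd (cval (n - 1))) \<mu>"
    using assms canonical_stage by (simp add: stage_play_def stage_play_axioms_def)
  from stage_play.fst_stage_value_le[OF this] stage_play.total_stage_value_le[OF this]
  show "fst (stage_value n (cval (n - 1)) \<mu>) \<le> fst (cval n)"
    and "total (stage_value n (cval (n - 1)) \<mu>) \<le> total (cval n)"
    using canonical_step[OF assms(1)] by simp_all
qed

lemma libertarian1_canonical: "libertarian1 c N (canonical c)"
  using canonical_equilibrium stage_value_le_canonical(1)
  by (auto simp: libertarian1_def selected_by_def)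

lemma follows_canonical_utilitarian:
  assumes "game_equilibrium c N \<pi>" "follows_canonical \<pi> N"
  shows "utilitarian c N \<pi>"
proof -
  have eq: "val \<pi> n = cval n" if "n \<le> N" for n
    using assms that by (intro follows_canonical_value[of N]) (auto simp: follows_canonical_def)
  have "total (stage_value n (val \<pi> (n - 1)) \<mu>) \<le> total (val \<pi> n)"
    if "n \<in> {2..N}" "stage_equilibrium n (val \<pi> (n - 1)) \<mu>" for n \<mu>
    using stage_value_le_canonical(2)[of n \<mu>] that eq[of "n - 1"] eq[of n] by auto
  then show ?thesis
    using assms(1) by (auto simp: utilitarian_def selected_by_def)
qed

lemma utilitarian_canonical: "utilitarian c N (canonical c)"
  by (rule follows_canonical_utilitarian) (auto simp: canonical_equilibrium follows_canonical_def)

section \<open>Utilitarian strategies compared with the canonical one\<close>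

definition lower_value :: "strategy \<Rightarrow> nat \<Rightarrow> real" where
  "lower_value \<pi> n = min (fst (val \<pi> n)) (snd (val \<pi> n))"

text \<open>The claims need each other in the induction: the bound on the total at the next stage
  uses both the total and the smaller value, and the equality case records how tightness
  propagates.\<close>

lemma utilitarian_vs_canonical:
  assumes "utilitarian c N \<pi>" "1 \<le> n" "n \<le> N"
  shows "snd (cval n) \<le> lower_value \<pi> n \<and> total (val \<pi> n) \<le> total (cval n) \<and>
    (lower_value \<pi> n = snd (cval n) \<longrightarrow>
      follows_canonical \<pi> n \<or> follows_canonical (swap_strategy \<pi>) n)"
  using assms(2,3)
proof (induction n rule: dec_induct)
  case base
  then show ?case by (simp add: lower_value_def follows_canonical_def)
next
  case (step n)
  have sel: "selected_by total c N \<pi>" and eq\<pi>: "game_equilibrium c N \<pi>"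
    using assms by (simp_all add: utilitarian_def selected_by_def)
  have n: "Suc n \<in> {2..N}" using step by simp
  define v w where "v = fst (val \<pi> n)" and "w = snd (val \<pi> n)"
  have val: "val \<pi> n = (v, w)" by (simp add: v_def w_def)
  have val_Suc: "val \<pi> (Suc n) = stage_value (Suc n) (v, w) (\<pi> (Suc n))"
    using game_value_step[of "Suc n" c \<pi>] n by (simp add: val)
  have cval_Suc: "cval (Suc n) = stage_value (Suc n) (cval n) (favoring1 (Suc n) (cval n))"
    using canonical_step[of "Suc n"] n by simp
  have m: "lower_value \<pi> n = min v w" by (simp add: lower_value_def val)
  have IH: "snd (cval n) \<le> min v w" "v + w \<le> fst (cval n) + snd (cval n)"
    "min v w = snd (cval n) \<Longrightarrow> follows_canonical \<pi> n \<or> follows_canonical (swap_strategy \<pi>) n"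
    using step by (auto simp: m val total_def)
  interpret play: stage_play "Suc n" v w "\<pi> (Suc n)"
    using selected_play[OF sel n] by (simp add: val)
  interpret swapped: stage_play "Suc n" w v "swap_strategy \<pi> (Suc n)"
    using play.swapped_play[OF play.equilibrium] by (simp add: swap_strategy_def)
  have total_le: "total (stage_value (Suc n) (v, w) (favoring1 (Suc n) (v, w))) \<le> total (val \<pi> (Suc n))"
    using selected_step[OF sel n] by (simp add: val)
  then have no_cont: "AE x in U01. max v w < x \<and> x < lone_value (Suc n - 1) \<longrightarrow>
      pmf (\<pi> (Suc n) x) (Continue, Continue) = 0"
    unfolding val_Suc by (rule play.AE_tie_no_continue)
  then have no_cont': "AE x in U01. max w v < x \<and> x < lone_value (Suc n - 1) \<longrightarrow>
      pmf (swap_strategy \<pi> (Suc n) x) (Continue, Continue) = 0"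
    by (simp add: swap_strategy_def pmf_map_swap max.commute)
  have swap_value: "stage_value (Suc n) (w, v) (swap_strategy \<pi> (Suc n)) = prod.swap (val \<pi> (Suc n))"
    unfolding val_Suc swap_strategy_def by (rule play.stage_value_swapped)
  have snd_ge: "least_value (Suc n) (min v w) \<le> snd (val \<pi> (Suc n))"
    using play.least_value_le_snd[OF no_cont] by (simp add: val_Suc)
  have fst_ge: "least_value (Suc n) (min v w) \<le> fst (val \<pi> (Suc n))"
    using swapped.least_value_le_snd[OF no_cont'] by (simp add: swap_value min.commute)
  have csnd: "snd (cval (Suc n)) = least_value (Suc n) (snd (cval n))"
    using canonical_snd[of "Suc n"] n by simp
  have mono: "least_value (Suc n) (snd (cval n)) \<le> least_value (Suc n) (min v w)"
    using IH(1) by (rule least_value_mono)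
  have 1: "snd (cval (Suc n)) \<le> lower_value \<pi> (Suc n)"
    using mono fst_ge snd_ge by (simp add: csnd lower_value_def)
  have 2: "total (val \<pi> (Suc n)) \<le> total (cval (Suc n))"
  proof -
    have "min (fst (cval n)) (snd (cval n)) = snd (cval n)"
      using canonical_snd_le_fst[of n] step.hyps by simp
    then have "total (stage_value (Suc n) (v, w) (favoring1 (Suc n) (v, w))) \<le> total (cval (Suc n))"
      using total_favoring1_mono(1)[OF play.stage_axioms, of "fst (cval n)" "snd (cval n)"]
        canonical_stage[of "Suc n"] IH n by (simp add: cval_Suc)
    then show ?thesis
      using play.total_stage_value_le by (simp add: val_Suc)
  qed
  have 3: "follows_canonical \<pi> (Suc n) \<or> follows_canonical (swap_strategy \<pi>) (Suc n)"
    if eq: "lower_value \<pi> (Suc n) = snd (cval (Suc n))"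
  proof -
    \<comment> \<open>Tightness means that one of the two players receives exactly the least value;
      the exchange of players covers the second possibility.\<close>
    have low: "snd (val \<pi> (Suc n)) \<le> least_value (Suc n) (min v w) \<or>
        fst (val \<pi> (Suc n)) \<le> least_value (Suc n) (min v w)"
      using eq mono by (auto simp: csnd lower_value_def)
    then have AE: "(AE x in U01. \<pi> (Suc n) x = favoring1 (Suc n) (v, w) x) \<and> (0 \<le> v \<longrightarrow> w \<le> v) \<or>
        (AE x in U01. swap_strategy \<pi> (Suc n) x = favoring1 (Suc n) (w, v) x) \<and> (0 \<le> w \<longrightarrow> v \<le> w)"
    proof
      assume "snd (val \<pi> (Suc n)) \<le> least_value (Suc n) (min v w)"
      from play.snd_eq_least_value[OF no_cont this[unfolded val_Suc]] show ?thesis by blast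
    next
      assume "fst (val \<pi> (Suc n)) \<le> least_value (Suc n) (min v w)"
      then have "snd (stage_value (Suc n) (w, v) (swap_strategy \<pi> (Suc n))) \<le> least_value (Suc n) (min w v)"
        by (simp add: swap_value min.commute)
      from swapped.snd_eq_least_value[OF no_cont' this] show ?thesis by blast
    qed
    show ?thesis
    proof (cases "n = 1")
      \<comment> \<open>At stage 1 the values coincide and no agreement has to be checked yet, so
        either player may become the favoured one.\<close>
      case True
      then have "v = fst (cval n)" "w = snd (cval n)" "v = w"
        by (simp_all add: v_def w_def)
      then have "cval n = (v, w)" "cval n = (w, v)"
        by (metis prod.collapse)+
      then have "canonical c (Suc n) = favoring1 (Suc n) (v, w)"
          "canonical c (Suc n) = favoring1 (Suc n) (w, v)"
        using canonical_eq[of c "Suc n"] by (metis diff_Suc_1)+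
      moreover have "follows_canonical \<rho> n" for \<rho>
        using True by (simp add: follows_canonical_def)
      ultimately show ?thesis
        using AE follows_canonical_Suc[OF step.hyps(1)] by metis
    next
      case False
      then have n2: "2 \<le> n" using step.hyps by simp
      have less: "0 < snd (cval n)" "snd (cval n) < fst (cval n)"
        using canonical_snd_pos canonical_snd_le_fst[of n] n2 by auto
      \<comment> \<open>Equality at stage \<open>Suc n\<close> collapses the chain of bounds, so
        strict monotonicity of \<open>least_value\<close> carries it down to stage \<open>n\<close>,
        where the induction hypothesis applies.\<close>
      have "least_value (Suc n) (min v w) \<le> least_value (Suc n) (snd (cval n))"
        using eq low fst_ge snd_ge by (auto simp: csnd lower_value_def min_def split: if_splits)
      then have "snd (cval n) = min v w"
        using least_value_inj[of "Suc n" "snd (cval n)" "min v w"] n less IH(1) play.v_less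
        by simp
      then consider "follows_canonical \<pi> n" | "follows_canonical (swap_strategy \<pi>) n"
        using IH(3) by auto
      then show ?thesis
      proof cases
        case 1
        then have "val \<pi> n = cval n"
          using follows_canonical_value[OF eq\<pi>] step by simp
        then have c: "cval n = (v, w)" by (simp add: val)
        then have "canonical c (Suc n) = favoring1 (Suc n) (v, w)"
          using canonical_eq[of c "Suc n"] by simp
        \<comment> \<open>Since \<open>0 < w < v\<close>, the alternative of \<open>AE\<close> that
          favours Player 2 is excluded: the favoured player cannot change.\<close>
        moreover have "\<not> (0 \<le> w \<longrightarrow> v \<le> w)" using less c by simp
        ultimately show ?thesis
          using AE 1 follows_canonical_Suc[OF step.hyps(1)] by metis
      next
        case 2
        then have "val (swap_strategy \<pi>) n = cval n"
          using follows_canonical_value[OF game_equilibrium_swap[OF eq\<pi>]] step by simp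
        then have c: "cval n = (w, v)" by (simp add: game_value_swap val)
        then have "canonical c (Suc n) = favoring1 (Suc n) (w, v)"
          using canonical_eq[of c "Suc n"] by simp
        moreover have "\<not> (0 \<le> v \<longrightarrow> w \<le> v)" using less c by simp
        ultimately show ?thesis
          using AE 2 follows_canonical_Suc[OF step.hyps(1)] by metis
      qed
    qed
  qed
  show ?case using 1 2 3 by blast
qed

section \<open>Characterisation of global optimality\<close>

lemma globally_optimal_iff:
  assumes "1 \<le> N"
  shows "globally_optimal c N \<pi> \<longleftrightarrow> utilitarian c N \<pi> \<and> total (val \<pi> N) = total (cval N)"
proof -
  have "total (val \<pi>' N) \<le> total (cval N)" if "utilitarian c N \<pi>'" for \<pi>'
    using utilitarian_vs_canonical[OF that, of N] assms by simp
  then show ?thesis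
    using utilitarian_canonical unfolding globally_optimal_def by (metis order_antisym)
qed

lemma globally_optimal_swap:
  assumes "1 \<le> N" "globally_optimal c N (swap_strategy \<pi>)"
  shows "globally_optimal c N \<pi>"
  using assms utilitarian_swap[of c N "swap_strategy \<pi>"]
  by (auto simp: globally_optimal_iff swap_strategy_swap_strategy game_value_swap total_def)

lemma libertarian1_globally_optimal:
  assumes "1 \<le> N" "libertarian1 c N \<pi>"
  shows "globally_optimal c N \<pi>"
proof -
  have eq: "game_equilibrium c N \<pi>"
    using assms by (simp add: libertarian1_def selected_by_def)
  have "follows_canonical \<pi> N"
    using assms(2) by (rule libertarian1_follows_canonical)
  then show ?thesis
    using follows_canonical_utilitarian[OF eq] follows_canonical_value[OF eq, of N] assms(1)
    by (simp add: globally_optimal_iff)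
qed

text \<open>Agreement before the first-played stage fixes the stage game at \<open>N\<close>, and
  all utilitarian choices there have the same total.\<close>

lemma globally_optimal_if_follows_canonical:
  assumes "2 \<le> N" "utilitarian c N \<pi>" "follows_canonical \<pi> (N - 1)"
  shows "globally_optimal c N \<pi>"
proof -
  have sel: "selected_by total c N \<pi>"
    using assms by (simp add: utilitarian_def)
  have "val \<pi> (N - 1) = cval (N - 1)"
    using follows_canonical_value[of N \<pi> "N - 1"] sel assms by (simp add: selected_by_def)
  then have "total (cval N) \<le> total (val \<pi> N)"
    using selected_step[OF sel, of N] canonical_step[of N] assms(1) by simp
  then show ?thesis
    using utilitarian_vs_canonical[OF assms(2), of N] assms by (simp add: globally_optimal_iff)
qed

lemma AE_eq_canonical_off_tie:
  assumes "2 \<le> N" "utilitarian c N \<pi>" "follows_canonical \<pi> (N - 1)" "n \<in> {2..N}"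
  shows "AE x in U01. \<pi> n x = canonical c n x \<or> (n = N \<and> x \<in> tie_region c \<pi> N)"
proof (cases "n = N")
  case True
  have sel: "selected_by total c N \<pi>"
    using assms by (simp add: utilitarian_def)
  have "val \<pi> (N - 1) = cval (N - 1)"
    using follows_canonical_value[of N \<pi> "N - 1"] sel assms by (simp add: selected_by_def)
  then show ?thesis
    using stage_play.AE_forced[OF selected_play[OF sel, of N]] assms(1) True
    by (auto simp: canonical_eq[of c N] tie_region_def elim!: eventually_mono)
next
  case False
  then have "n \<in> {2..N - 1}" using assms by auto
  then have "AE x in U01. \<pi> n x = canonical c n x"
    using assms(3) by (simp add: follows_canonical_def)
  then show ?thesis by (rule eventually_mono) simp
qed

lemma globally_optimal_follows_canonical:
  assumes "3 \<le> N" "globally_optimal c N \<pi>"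
  shows "follows_canonical \<pi> (N - 1) \<or> follows_canonical (swap_strategy \<pi>) (N - 1)"
proof -
  have util: "utilitarian c N \<pi>" and total: "total (val \<pi> N) = total (cval N)"
    using assms by (simp_all add: globally_optimal_iff)
  have sel: "selected_by total c N \<pi>"
    using util by (simp add: utilitarian_def)
  let ?v = "fst (val \<pi> (N - 1))" and ?w = "snd (val \<pi> (N - 1))"
  let ?v' = "fst (cval (N - 1))" and ?w' = "snd (cval (N - 1))"
  interpret stage_play N ?v ?w "\<pi> N"
    using selected_play[OF sel, of N] assms by simp
  \<comment> \<open>\<open>N \<ge> 3\<close> makes \<open>N - 1\<close> at least 2, where the
    canonical values are already strictly ordered and positive.\<close>
  have less: "0 < ?w'" "?w' < ?v'"
    using canonical_snd_pos[of "N - 1"] canonical_snd_le_fst[of "N - 1"] assms(1) by auto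
  have bound: "?w' \<le> min ?v ?w" "?v + ?w \<le> ?v' + ?w'"
    and imp: "min ?v ?w = ?w' \<longrightarrow> follows_canonical \<pi> (N - 1) \<or> follows_canonical (swap_strategy \<pi>) (N - 1)"
    using utilitarian_vs_canonical[OF util, of "N - 1"] assms(1)
    by (auto simp: lower_value_def total_def)
  have "total (cval N) \<le> total (stage_value N (?v, ?w) (favoring1 N (?v, ?w)))"
    using total_stage_value_le total game_value_step[of N c \<pi>] assms(1) by simp
  \<comment> \<open>An optimal total at \<open>N\<close> is the equality case of the comparison of
    totals, so the smaller values at \<open>N - 1\<close> agree.\<close>
  then have "min ?v ?w = min ?v' ?w'"
    using total_favoring1_mono(2)[OF stage_axioms canonical_stage[of N]] canonical_step[of N]
      bound less assms(1) by simp
  then show ?thesis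
    using imp less by simp
qed

lemma globally_optimal_iff_libertarian:
  assumes "3 \<le> N"
  shows "globally_optimal c N \<pi> \<longleftrightarrow>
     utilitarian c N \<pi> \<and>
     (\<exists>\<rho>. (libertarian1 c N \<rho> \<or> libertarian2 c N \<rho>) \<and>
        (\<forall>n\<in>{2..N}. AE x in U01. \<pi> n x = \<rho> n x \<or> (n = N \<and> x \<in> tie_region c \<pi> N)))"
    (is "_ \<longleftrightarrow> _ \<and> (\<exists>\<rho>. _ \<and> ?agree \<pi> \<rho>)")
proof
  assume opt: "globally_optimal c N \<pi>"
  then have util: "utilitarian c N \<pi>" by (simp add: globally_optimal_def)
  consider "follows_canonical \<pi> (N - 1)" | "follows_canonical (swap_strategy \<pi>) (N - 1)"
    using globally_optimal_follows_canonical[OF assms opt] by blast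
  then have "\<exists>\<rho>. (libertarian1 c N \<rho> \<or> libertarian2 c N \<rho>) \<and> ?agree \<pi> \<rho>"
  proof cases
    case 1
    then show ?thesis
      using libertarian1_canonical AE_eq_canonical_off_tie[OF _ util] assms
      by (intro exI[of _ "canonical c"]) auto
  next
    case 2
    let ?\<rho> = "swap_strategy (canonical c)"
    have "libertarian2 c N ?\<rho>"
      by (simp add: libertarian2_iff swap_strategy_swap_strategy libertarian1_canonical)
    moreover have "?agree \<pi> ?\<rho>"
    proof
      fix n assume "n \<in> {2..N}"
      with assms 2 have "AE x in U01. swap_strategy \<pi> n x = canonical c n x \<or> (n = N \<and> x \<in> tie_region c \<pi> N)"
        using AE_eq_canonical_off_tie[OF _ utilitarian_swap[OF util]] by (simp add: tie_region_swap)
      moreover have "swap_strategy \<pi> n x = canonical c n x \<longleftrightarrow> \<pi> n x = ?\<rho> n x" for x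
        by (metis swap_strategy_eq_iff swap_strategy_swap_strategy)
      ultimately show "AE x in U01. \<pi> n x = ?\<rho> n x \<or> (n = N \<and> x \<in> tie_region c \<pi> N)"
        by (simp only:)
    qed
    ultimately show ?thesis by blast
  qed
  with util show "utilitarian c N \<pi> \<and> (\<exists>\<rho>. (libertarian1 c N \<rho> \<or> libertarian2 c N \<rho>) \<and> ?agree \<pi> \<rho>)"
    by blast
next
  have opt: "globally_optimal c N \<pi>"
    if "utilitarian c N \<pi>" "libertarian1 c N \<rho>" "?agree \<pi> \<rho>" for \<pi> \<rho>
  proof -
    \<comment> \<open>The exception for ties concerns only \<open>n = N\<close>, so at these stages
      agreement with \<open>\<rho>\<close> is unconditional.\<close>
    have "AE x in U01. \<pi> n x = canonical c n x" if n: "n \<in> {2..N - 1}" for n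
    proof -
      from n assms have "n \<in> {2..N}" "n \<noteq> N" by auto
      then have "AE x in U01. \<pi> n x = \<rho> n x" "AE x in U01. \<rho> n x = canonical c n x"
        using \<open>?agree \<pi> \<rho>\<close> libertarian1_follows_canonical[OF \<open>libertarian1 c N \<rho>\<close>]
        by (auto simp: follows_canonical_def)
      then show ?thesis by eventually_elim simp
    qed
    then show ?thesis
      using that assms by (intro globally_optimal_if_follows_canonical) (auto simp: follows_canonical_def)
  qed
  assume "utilitarian c N \<pi> \<and> (\<exists>\<rho>. (libertarian1 c N \<rho> \<or> libertarian2 c N \<rho>) \<and> ?agree \<pi> \<rho>)"
  then obtain \<rho> where util: "utilitarian c N \<pi>" and agree: "?agree \<pi> \<rho>"
    and "libertarian1 c N \<rho> \<or> libertarian2 c N \<rho>"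
    by blast
  then consider "libertarian1 c N \<rho>" | "libertarian1 c N (swap_strategy \<rho>)"
    by (auto simp: libertarian2_iff)
  then show "globally_optimal c N \<pi>"
  proof cases
    case 1
    then show ?thesis using opt util agree by blast
  next
    case 2
    \<comment> \<open>The tie region is symmetric in the players, so exchanging them in both
      strategies preserves agreement and reduces to the first case.\<close>
    have "?agree (swap_strategy \<pi>) (swap_strategy \<rho>)"
      unfolding swap_strategy_eq_iff tie_region_swap by (rule agree)
    then have "globally_optimal c N (swap_strategy \<pi>)"
      by (rule opt[OF utilitarian_swap[OF util] 2])
    then show ?thesis
      using globally_optimal_swap[of N \<pi>] assms by simp
  qed
qed

end

theorem theorem2:
  fixes c :: real and N :: nat
  assumes "c \<ge> 0" and "N \<ge> 3"
  shows "(\<exists>\<pi>. libertarian1 c N \<pi>) \<and> (\<exists>\<pi>. libertarian2 c N \<pi>) \<and>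
    (\<forall>\<pi>. libertarian1 c N \<pi> \<or> libertarian2 c N \<pi> \<longrightarrow> globally_optimal c N \<pi>) \<and>
    (\<forall>\<pi>. globally_optimal c N \<pi> \<longleftrightarrow>
       utilitarian c N \<pi> \<and>
       (\<exists>\<rho>. (libertarian1 c N \<rho> \<or> libertarian2 c N \<rho>) \<and>
          (\<forall>n\<in>{2..N}. AE x in U01. \<pi> n x = \<rho> n x \<or> (n = N \<and> x \<in> tie_region c \<pi> N))))"
proof -
  interpret game c
    using assms(1) by unfold_locales
  have "libertarian2 c N (swap_strategy (canonical c))"
    by (simp add: libertarian2_iff swap_strategy_swap_strategy libertarian1_canonical)
  moreover have "globally_optimal c N \<pi>" if "libertarian1 c N \<pi> \<or> libertarian2 c N \<pi>" for \<pi>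
    using that libertarian1_globally_optimal[of N] globally_optimal_swap[of N \<pi>] assms(2)
    by (auto simp: libertarian2_iff)
  ultimately show ?thesis
    using libertarian1_canonical globally_optimal_iff_libertarian[OF assms(2)] by blast
qed

end
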